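(* Let $m\ge1$, let $\mathfrak g$ be the Lie algebra of the gauge group, with structure constants $f^{\mathsf{abc}}$, let $\mathbf p\in\mathbb N_0^{2m}$ and $P=\sum_{i=1}^{2m}p_i$. The semi-classical action of the conformally soft hyperholomorphic charge $Q^{\mathsf a}[\mathbf p](z)$ on the (hard) conformal primary hyperholomorphic gluon vertex operator $V^{\mathsf b}_\Delta(z',\tilde z)$ is, on the patch $\tilde z_{\dot\alpha}=(1,\tilde z_2,\dots,\tilde z_{2m})$, the celestial OPE $$Q^{\mathsf a}[\mathbf p](z)\,V^{\mathsf b}_\Delta(z',\tilde z)\sim\frac{f^{\mathsf{abc}}}{z-z'}\Big(\prod_{r=0}^{p_1-1}(\tilde\Upsilon+\Delta-2-r)\Big)\prod_{b=2}^{2m}\tilde\partial_b^{\,p_b}\;V^{\mathsf c}_{\Delta-P}(z,\tilde z),$$ or equivalently, expanding the product of differential operators, $$Q^{\mathsf a}[\mathbf p](z)\,V^{\mathsf b}_\Delta(z',\tilde z)\sim\frac{f^{\mathsf{abc}}}{z-z'}\sum_{L=0}^{p_1}\frac{\Gamma(\Delta-1)}{\Gamma(\Delta-1-p_1+L)}\binom{p_1}{L}\sum_{\substack{\ell_2,\dots,\ell_{2m}\ge0\\ \ell_2+\cdots+\ell_{2m}=L}}\frac{L!}{\ell_2!\cdots\ell_{2m}!}\prod_{b=2}^{2m}\tilde z_b^{\,\ell_b}\,\tilde\partial_b^{\,\ell_b+p_b}\;V^{\mathsf c}_{\Delta-P}(z,\tilde z).$$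
   Context: $Z=(\mu^{\dot\alpha},\lambda_\alpha)$, with $\alpha\in\{0,1\}$ and $\dot\alpha\in\{1,\dots,2m\}$, are homogeneous coordinates on the flat twistor space $\{[Z]\in\mathbb P^{2m+1}\,|\,\lambda_\alpha\ne0\}$. $\langle a\,b\rangle=a^\alpha b_\alpha$ and $[\tilde a\,\tilde b]=\tilde a^{\dot\alpha}\tilde b_{\dot\alpha}$ are the invariant skew pairings of $SL(2,\mathbb C)$ and $Sp(m,\mathbb C)$, and $D\lambda=\langle\lambda\,d\lambda\rangle$. The constant spinor is $\iota_\alpha=(0,1)$, and affine coordinates are $\lambda_\alpha=(1,\lambda)$, $z_\alpha=(1,z)$, so that $\langle\iota\,\lambda\rangle=\langle\iota\,z\rangle=1$ and $\langle\lambda\,z\rangle=\lambda-z$. Set $w[\mathbf p]=(\mu^{\dot1})^{p_1}\cdots(\mu^{\dot{2m}})^{p_{2m}}$, $\tilde\partial_a=\partial/\partial\tilde z_a$ for $a=2,\dots,2m$, and $\tilde\Upsilon=\sum_{a=2}^{2m}\tilde z_a\tilde\partial_a$. The twistor sigma model has fermionic fields $\rho^i,\bar\rho_i$ (sections of $K^{1/2}_{\mathbb P^1}$ in the fundamental and anti-fundamental representations) with free action $\int\bar\rho_i\,\bar\partial\rho^i$ over a twistor line. The Kac–Moody currents are $j^{\mathsf a}=(\mathsf T^{\mathsf a})^i{}_j\,\bar\rho_i\,\rho^j$ (normal ordered, $\mathsf T^{\mathsf a}$ generators of $\mathfrak g$), with semi-classical OPE (single Wick contraction only, hence no double pole) $$j^{\mathsf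 a}(\lambda)\,j^{\mathsf b}(\lambda')\sim f^{\mathsf{abc}}\,\frac{j^{\mathsf c}(\lambda')}{\langle\lambda\,\lambda'\rangle}\,\frac{\langle\iota\,\lambda'\rangle}{\langle\iota\,\lambda\rangle}\,D\lambda .$$ A hyperholomorphic gluon has momentum $k^{\alpha\dot\alpha}=\omega\,z^\alpha\tilde z^{\dot\alpha}$, with $z^\alpha$ and $\tilde z^{\dot\alpha}$ homogeneous coordinates on $\mathbb P^1$ and $\mathbb P^{2m-1}$. The conformal primary vertex operator of dimension $\Delta$ is $$V^{\mathsf b}_\Delta(z',\tilde z)=(-i)^{\Delta-1}\,\Gamma(\Delta-1)\int j^{\mathsf b}\wedge\frac{\bar\delta_{\Delta-1}(\langle\lambda\,z'\rangle)}{[\mu\,\tilde z]^{\Delta-1}},\qquad \bar\delta_n(\langle\lambda\,z\rangle)=\Big(\frac{\langle\iota\,\lambda\rangle}{\langle\iota\,z\rangle}\Big)^{n+1}\frac1{2\pi i}\,\bar\partial\Big(\frac1{\langle\lambda\,z\rangle}\Big).$$ The soft charge is $$Q^{\mathsf a}[\mathbf p](z)=\frac{i^P}{2\pi i}\oint_{\gamma_z}\frac{w[\mathbf p]\,\langle\iota\,\lambda\rangle^{1-P}}{\langle\lambda\,z\rangle\,\langle\iota\,z\rangle^{1-P}}\,j^{\mathsf a},$$ with $\gamma_z$ a small circle around $\langle\lambda\,z\rangle=0$. Its action on $V^{\mathsf b}_\Delta$ is computed with the current OPE above, performing the contour integral and using the support of the delta function. The symbol $\sim$ denotes the singular part of the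 OPE, and $\mathsf c$ is summed over.
   Formalization: The printed OPEs are off by a sign in the stated conventions (e.g. m=1, p=(0,1)); both right-hand sides carry the extra factor (-1)^{p_2+...+p_{2m}}; Δ-1-P is assumed not to be a non-positive integer, so that the Gamma function in V_{Δ-P} is defined. *)

theory Defs
  imports "HOL-Complex_Analysis.Complex_Analysis"
begin

section \<open>Spinors on the affine patch\<close>

text \<open>
  Spinors carry lower indices. The pairing is the one normalised by
  \<open>\<langle>\<iota> \<lambda>\<rangle> = 1\<close> and \<open>\<langle>\<lambda> z\<rangle> = \<lambda> - z\<close> on the patch \<open>\<lambda>\<^sub>\<alpha> = (1,\<lambda>)\<close>.
\<close>

type_synonym spinor = "complex \<times> complex"

definition angle :: "spinor \<Rightarrow> spinor \<Rightarrow> complex" where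
  "angle a b = snd a * fst b - fst a * snd b"

definition aff :: "complex \<Rightarrow> spinor" where
  "aff l = (1, l)"

definition iota :: spinor where
  "iota = (0, 1)"

text \<open>
  The coefficient of \<open>d\<lambda>\<close> in \<open>D\<lambda> = \<langle>\<lambda> d\<lambda>\<rangle>\<close>; with the above pairing it equals \<open>-1\<close>.
\<close>

definition Dcoeff :: "complex \<Rightarrow> complex" where
  "Dcoeff l = angle (aff l) (0, 1)"

text \<open>
  \<open>\<integral> g D\<lambda>\<close> over an arbitrarily small circle \<open>\<gamma>\<^sub>z\<close> about \<open>\<langle>\<lambda> z\<rangle> = 0\<close>, with the orientation for
  which \<open>D\<lambda> / \<langle>\<lambda> z\<rangle>\<close> integrates to \<open>2\<pi>i\<close>. Since \<open>D\<lambda> = -d\<lambda>\<close>, this is clockwise in \<open>\<lambda>\<close>.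
\<close>

definition circle_integral :: "complex \<Rightarrow> (complex \<Rightarrow> complex) \<Rightarrow> complex" where
  "circle_integral z g =
     Lim (at_right 0) (\<lambda>\<epsilon>. contour_integral (reversepath (circlepath z \<epsilon>)) (\<lambda>l. g l * Dcoeff l))"

text \<open>
  \<open>\<integral> g D\<lambda> \<and> \<delta>\<^sub>n(\<langle>\<lambda> z\<rangle>)\<close> for
  \<open>\<delta>\<^sub>n(\<langle>\<lambda> z\<rangle>) = (\<langle>\<iota> \<lambda>\<rangle> / \<langle>\<iota> z\<rangle>)\<^sup>n\<^sup>+\<^sup>1 (2\<pi>i)\<^sup>-\<^sup>1 dbar (1 / \<langle>\<lambda> z\<rangle>)\<close>.
  Here \<open>dbar (1/h)\<close> is the residue current of \<open>1/h\<close>: its value on a (1,0)-form \<open>\<omega>\<close>, that is,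
  \<open>\<integral> dbar (1/h) \<and> \<omega>\<close>, is the limit for \<open>\<epsilon> \<rightarrow> 0\<close> of the integral of \<open>\<omega> / h\<close> over the
  counterclockwise curve \<open>\<bar>h\<bar> = \<epsilon>\<close>. The order of the wedge product in \<open>\<omega> \<and> dbar (1/h)\<close> turns this
  into the clockwise curve, so that \<open>\<integral> D\<lambda> \<and> \<delta>\<^sub>n(\<langle>\<lambda> z\<rangle>) = 1\<close>.
\<close>

definition delta_integral :: "complex \<Rightarrow> complex \<Rightarrow> (complex \<Rightarrow> complex) \<Rightarrow> complex" where
  "delta_integral n z g =
     1 / (2 * of_real pi * \<i>) *
     circle_integral z (\<lambda>l. g l * (angle iota (aff l) / angle iota (aff z)) powr (n + 1)
                              / angle (aff l) (aff z))"

section \<open>Operator products\<close>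

text \<open>
  An operator is represented by its correlators with arbitrary fixed spectator insertions, and
  \<open>U\<close> is an open part of the affine patch that contains no spectators. \<open>F \<sim> G\<close> means that
  \<open>F - G\<close> extends holomorphically over the diagonal. A continuous function that is holomorphic
  in each variable is jointly holomorphic (Osgood).
\<close>

definition regular2 :: "complex set \<Rightarrow> (complex \<Rightarrow> complex \<Rightarrow> complex) \<Rightarrow> bool" where
  "regular2 U R \<longleftrightarrow>
     continuous_on (U \<times> U) (\<lambda>(x, y). R x y) \<and>
     (\<forall>y\<in>U. (\<lambda>x. R x y) holomorphic_on U) \<and>
     (\<forall>x\<in>U. (\<lambda>y. R x y) holomorphic_on U)"

definition ope_sim ::
  "complex set \<Rightarrow> (complex \<Rightarrow> complex \<Rightarrow> complex) \<Rightarrow> (complex \<Rightarrow> complex \<Rightarrow> complex) \<Rightarrow> bool" where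
  "ope_sim U F G \<longleftrightarrow>
     (\<exists>R. regular2 U R \<and> (\<forall>x\<in>U. \<forall>y\<in>U. x \<noteq> y \<longrightarrow> F x y = G x y + R x y))"

definition structure_constants :: "('g::finite \<Rightarrow> 'g \<Rightarrow> 'g \<Rightarrow> complex) \<Rightarrow> bool" where
  "structure_constants f \<longleftrightarrow>
     (\<forall>a b c. f a b c = - f b a c) \<and>
     (\<forall>a b c e. (\<Sum>d\<in>UNIV. f a b d * f d c e + f b c d * f d a e + f c a d * f d b e) = 0)"

text \<open>
  \<open>J a \<lambda>\<close> is the coefficient of \<open>D\<lambda>\<close> in \<open>j\<^sup>a(\<lambda>)\<close>, and \<open>JJ a b \<lambda> \<lambda>'\<close> that of \<open>D\<lambda> D\<lambda>'\<close> in the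
  operator product \<open>j\<^sup>a(\<lambda>) j\<^sup>b(\<lambda>')\<close>. At the semi-classical level the latter has no double pole.
\<close>

definition semiclassical_currents ::
  "complex set \<Rightarrow> ('g::finite \<Rightarrow> 'g \<Rightarrow> 'g \<Rightarrow> complex) \<Rightarrow> ('g \<Rightarrow> complex \<Rightarrow> complex) \<Rightarrow>
   ('g \<Rightarrow> 'g \<Rightarrow> complex \<Rightarrow> complex \<Rightarrow> complex) \<Rightarrow> bool" where
  "semiclassical_currents U f J JJ \<longleftrightarrow>
     (\<forall>a. J a holomorphic_on U) \<and>
     (\<forall>a b. ope_sim U (JJ a b)
        (\<lambda>l l'. \<Sum>c\<in>UNIV. f a b c * (J c l' / angle (aff l) (aff l'))
                           * (angle iota (aff l') / angle iota (aff l))))"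

section \<open>Vertex operators and soft charges\<close>

text \<open>
  Dotted indices range over \<open>{1..2*m}\<close>; \<open>\<mu> i \<lambda>\<close> is the \<open>i\<close>-th component along the twistor line.
\<close>

definition bracket :: "nat \<Rightarrow> (nat \<Rightarrow> complex) \<Rightarrow> (nat \<Rightarrow> complex) \<Rightarrow> complex" where
  "bracket m u v = (\<Sum>i=1..2*m. u i * v i)"

definition patch :: "(nat \<Rightarrow> complex) \<Rightarrow> nat \<Rightarrow> complex" where
  "patch zt = zt(1 := 1)"

definition log_branch :: "complex set \<Rightarrow> (complex \<Rightarrow> complex) \<Rightarrow> bool" where
  "log_branch D lg \<longleftrightarrow> open D \<and> lg holomorphic_on D \<and> (\<forall>x\<in>D. exp (lg x) = x)"

text \<open>
  The conformal primary built from the current \<open>j\<close>. The branch \<open>lg\<close> of the logarithm fixes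
  \<open>[\<mu> z]\<^sup>s\<close> as \<open>exp (s * lg [\<mu> z])\<close>.
\<close>

definition vertex_op ::
  "nat \<Rightarrow> (nat \<Rightarrow> complex \<Rightarrow> complex) \<Rightarrow> (complex \<Rightarrow> complex) \<Rightarrow> (complex \<Rightarrow> complex) \<Rightarrow>
   complex \<Rightarrow> complex \<Rightarrow> (nat \<Rightarrow> complex) \<Rightarrow> complex" where
  "vertex_op m \<mu> lg j \<Delta> z zt =
     (- \<i>) powr (\<Delta> - 1) * Gamma (\<Delta> - 1) *
     delta_integral (\<Delta> - 1) z
       (\<lambda>l. j l / exp ((\<Delta> - 1) * lg (bracket m (\<lambda>i. \<mu> i l) (patch zt))))"

definition weight :: "nat \<Rightarrow> (nat \<Rightarrow> nat) \<Rightarrow> nat" where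
  "weight m p = (\<Sum>i=1..2*m. p i)"

definition soft_charge ::
  "nat \<Rightarrow> (nat \<Rightarrow> complex \<Rightarrow> complex) \<Rightarrow> (nat \<Rightarrow> nat) \<Rightarrow> (complex \<Rightarrow> complex) \<Rightarrow>
   complex \<Rightarrow> complex" where
  "soft_charge m \<mu> p j z =
     \<i> ^ weight m p / (2 * of_real pi * \<i>) *
     circle_integral z
       (\<lambda>l. (\<Prod>i=1..2*m. \<mu> i l ^ p i) * angle iota (aff l) powi (1 - int (weight m p))
            / (angle (aff l) (aff z) * angle iota (aff z) powi (1 - int (weight m p)))
            * j l)"

text \<open>
  The product \<open>Q\<^sup>a[p](z) V\<^sup>b\<^sub>\<Delta>(z',z)\<close>: \<open>j\<^sup>a(\<lambda>)\<close> in the charge and \<open>j\<^sup>b(\<lambda>')\<close> in the vertex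
  operator are multiplied with the operator product \<open>JJ a b\<close> of the currents.
\<close>

definition charge_on_vertex ::
  "nat \<Rightarrow> (nat \<Rightarrow> complex \<Rightarrow> complex) \<Rightarrow> (complex \<Rightarrow> complex) \<Rightarrow> (nat \<Rightarrow> nat) \<Rightarrow>
   ('g \<Rightarrow> 'g \<Rightarrow> complex \<Rightarrow> complex \<Rightarrow> complex) \<Rightarrow> 'g \<Rightarrow> 'g \<Rightarrow>
   complex \<Rightarrow> complex \<Rightarrow> complex \<Rightarrow> (nat \<Rightarrow> complex) \<Rightarrow> complex" where
  "charge_on_vertex m \<mu> lg p JJ a b \<Delta> z z' zt =
     soft_charge m \<mu> p (\<lambda>l. vertex_op m \<mu> lg (\<lambda>l'. JJ a b l l') \<Delta> z' zt) z"

section \<open>Differential operators in the affine coordinates \<open>zt a\<close>, \<open>a \<in> {2..2*m}\<close>\<close>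

text \<open>
  Sign check: \<open>pd b\<close> sends \<open>[\<mu> z]\<^sup>-\<^sup>s\<close> to \<open>-s \<mu>\<^sup>b [\<mu> z]\<^sup>-\<^sup>s\<^sup>-\<^sup>1\<close>, whereas \<open>euler + s\<close> sends it to
  \<open>+s \<mu>\<^sup>1 [\<mu> z]\<^sup>-\<^sup>s\<^sup>-\<^sup>1\<close>. With \<open>i\<^sup>P\<close> in the charge and \<open>(-i)\<^sup>\<Delta>\<^sup>-\<^sup>1\<close> in the vertex operator, each \<open>pd b\<close>
  with \<open>b \<ge> 2\<close> in the celestial OPE therefore comes with a factor \<open>-1\<close>.
\<close>

type_synonym fld = "(nat \<Rightarrow> complex) \<Rightarrow> complex"

definition pd :: "nat \<Rightarrow> fld \<Rightarrow> fld" where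
  "pd a F zt = deriv (\<lambda>t. F (zt(a := t))) (zt a)"

definition euler :: "nat \<Rightarrow> fld \<Rightarrow> fld" where
  "euler m F zt = (\<Sum>a=2..2*m. zt a * pd a F zt)"

definition pd_multi :: "nat \<Rightarrow> (nat \<Rightarrow> nat) \<Rightarrow> fld \<Rightarrow> fld" where
  "pd_multi m q = foldr (\<lambda>b D. (pd b ^^ q b) \<circ> D) [2..<2*m+1] id"

definition euler_prod :: "nat \<Rightarrow> complex \<Rightarrow> nat \<Rightarrow> fld \<Rightarrow> fld" where
  "euler_prod m \<Delta> k =
     foldr (\<lambda>r D. (\<lambda>F zt. euler m F zt + (\<Delta> - 2 - of_nat r) * F zt) \<circ> D) [0..<k] id"

definition euler_expanded :: "nat \<Rightarrow> complex \<Rightarrow> (nat \<Rightarrow> nat) \<Rightarrow> fld \<Rightarrow> fld" where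
  "euler_expanded m \<Delta> p F zt =
     (\<Sum>L=0..p 1.
        Gamma (\<Delta> - 1) / Gamma (\<Delta> - 1 - of_nat (p 1) + of_nat L) * of_nat (p 1 choose L) *
        (\<Sum>l\<in>{l \<in> {2..2*m} \<rightarrow>\<^sub>E UNIV. (\<Sum>b=2..2*m. l b) = L}.
           fact L / (\<Prod>b=2..2*m. fact (l b)) * (\<Prod>b=2..2*m. zt b ^ l b) *
           pd_multi m (\<lambda>b. l b + p b) F zt))"

end

(* Both contour integrals are residues. The vertex operator is a constant times j(z) [mu z]^-(Delta-1),
   and the charge multiplies the current product at z by the monomial w[p](z). On powers of the
   pairing, pd_b lowers [mu z]^-s to -s mu_b [mu z]^-(s+1) and Upsilon + s to s mu_1 [mu z]^-(s+1), so
   the differential operators of the celestial OPE rebuild w[p] and shift Delta - P to Delta; the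
   Pochhammer factor turns Gamma(Delta-P-1) into Gamma(Delta-1). The two sides then differ by
   the regular part of the current OPE and by divided differences of holomorphic functions, which
   come from evaluating J and [mu z] at z' instead of z. The expanded operator gives the same value
   by the multinomial and the binomial theorem, since sum_(b>=2) z_b mu_b = [mu z] - mu_1. *)
theory Submission
  imports Defs
begin

section \<open>Residues\<close>

text \<open>Cauchy's formula gives the same value on every circle inside \<open>V\<close>, so the
  limit is that of an eventually constant function. The coefficient \<open>Dcoeff = -1\<close> and
  the reversed orientation each contribute a sign, and the two cancel.\<close>

lemma circle_integral_eval:
  assumes "open V" "z \<in> V" "h holomorphic_on V"
    and g: "\<And>l. l \<in> V \<Longrightarrow> l \<noteq> z \<Longrightarrow> g l = h l / (l - z)"
  shows "circle_integral z g = 2 * of_real pi * \<i> * h z"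
proof -
  obtain e where e: "e > 0" "cball z e \<subseteq> V"
    using assms open_contains_cball by blast
  have "contour_integral (reversepath (circlepath z r)) (\<lambda>l. g l * Dcoeff l)
          = 2 * of_real pi * \<i> * h z" if r: "0 < r" "r < e" for r
  proof -
    have sub: "cball z r \<subseteq> V" using e r by auto
    have "((\<lambda>u. h u / (u - z)) has_contour_integral (2 * of_real pi * \<i> * h z)) (circlepath z r)"
      using Cauchy_integral_circlepath_simple[of h z r z] assms(3) sub r
      by (auto intro: holomorphic_on_subset)
    then have "((\<lambda>u. - (h u / (u - z))) has_contour_integral - (2 * of_real pi * \<i> * h z))
        (circlepath z r)"
      by (rule has_contour_integral_neg)
    then have "((\<lambda>u. g u * Dcoeff u) has_contour_integral - (2 * of_real pi * \<i> * h z))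
        (circlepath z r)"
    proof (rule has_contour_integral_eq)
      fix x assume x: "x \<in> path_image (circlepath z r)"
      then have "x \<in> V" "x \<noteq> z" using sub r by auto
      then show "- (h x / (x - z)) = g x * Dcoeff x"
        by (simp add: g Dcoeff_def angle_def aff_def)
    qed
    then have "((\<lambda>u. g u * Dcoeff u) has_contour_integral - (- (2 * of_real pi * \<i> * h z)))
        (reversepath (circlepath z r))"
      by (intro has_contour_integral_reversepath) auto
    then show ?thesis by (simp add: contour_integral_unique)
  qed
  then have "\<forall>\<^sub>F r in at_right 0. contour_integral (reversepath (circlepath z r))
      (\<lambda>l. g l * Dcoeff l) = 2 * of_real pi * \<i> * h z"
    unfolding eventually_at_right_field using e by auto
  then show ?thesis
    unfolding circle_integral_def
    by (intro tendsto_Lim tendsto_eventually) auto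
qed

text \<open>On the affine patch \<open>angle iota (aff l) = 1\<close>, so the weight factor is a
  power of 1 whatever \<open>n\<close> is, and a simple pole with residue \<open>g z\<close> is
  left.\<close>

lemma delta_integral_eval:
  assumes "open V" "z \<in> V" "g holomorphic_on V"
  shows "delta_integral n z g = g z"
proof -
  have "circle_integral z (\<lambda>l. g l * (angle iota (aff l) / angle iota (aff z)) powr (n + 1)
      / angle (aff l) (aff z)) = 2 * of_real pi * \<i> * g z"
    by (rule circle_integral_eval[OF assms]) (simp add: angle_def aff_def iota_def)
  then show ?thesis by (simp add: delta_integral_def)
qed

section \<open>Powers of the pairing with a fixed branch\<close>

text \<open>This is [mu z]^(-s) in the branch \<open>lg\<close>, with \<open>u\<close> the value of
  mu at one fixed point of the line. Negating the exponent makes each differentiation raise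
  \<open>s\<close> by one.\<close>

definition bracket_pow ::
  "nat \<Rightarrow> (nat \<Rightarrow> complex) \<Rightarrow> (complex \<Rightarrow> complex) \<Rightarrow> complex \<Rightarrow> fld" where
  "bracket_pow m u lg s zt = exp (- s * lg (bracket m u (patch zt)))"

text \<open>Differentiate \<open>exp (lg y) = y\<close> on the open set \<open>D\<close>.\<close>

lemma log_branch_has_field_derivative:
  assumes "log_branch D lg" "x \<in> D"
  shows "(lg has_field_derivative 1 / x) (at x)"
proof -
  have D: "open D" "lg holomorphic_on D" "\<And>y. y \<in> D \<Longrightarrow> exp (lg y) = y"
    using assms by (auto simp: log_branch_def)
  have lg: "(lg has_field_derivative deriv lg x) (at x)"
    using D assms holomorphic_derivI by blast
  have "((\<lambda>y. exp (lg y)) has_field_derivative exp (lg x) * deriv lg x) (at x)"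
    using lg by (auto intro!: derivative_eq_intros)
  then have "((\<lambda>y. y) has_field_derivative exp (lg x) * deriv lg x) (at x)"
    by (rule has_field_derivative_transform_within_open[OF _ D(1) assms(2)]) (use D in auto)
  \<comment> \<open>This equation also forces \<open>x\<close> to be nonzero, which allows the
    division that follows.\<close>
  then have "x * deriv lg x = 1"
    using DERIV_unique[OF _ DERIV_ident] D(3) assms(2) by metis
  then have "deriv lg x = 1 / x"
    by (metis mult_zero_left nonzero_mult_div_cancel_left zero_neq_one)
  with lg show ?thesis by simp
qed

lemma bracket_pow_step:
  assumes "log_branch D lg" "bracket m u (patch zt) \<in> D"
  shows "bracket m u (patch zt) ^ n * bracket_pow m u lg (s + of_nat n) zt = bracket_pow m u lg s zt"
proof -
  let ?x = "bracket m u (patch zt)"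
  have "exp (lg ?x) = ?x" using assms by (auto simp: log_branch_def)
  then have "?x ^ n = exp (of_nat n * lg ?x)"
    by (simp add: exp_of_nat_mult)
  then show ?thesis
    by (simp add: bracket_pow_def flip: exp_add) (simp add: algebra_simps)
qed

lemma bracket_patch:
  assumes "m \<ge> 1"
  shows "bracket m u (patch zt) = u 1 + (\<Sum>a=2..2*m. u a * zt a)"
proof -
  have "{1..2*m} = insert 1 {2..2*m}" using assms by auto
  then show ?thesis by (simp add: bracket_def patch_def)
qed

lemma bracket_patch_upd:
  assumes "a \<in> {2..2*m}"
  shows "bracket m u (patch (zt(a := t))) = bracket m u (patch zt) + u a * (t - zt a)"
proof -
  have "a \<in> {1..2*m}" using assms by auto
  then show ?thesis
    using assms unfolding bracket_def patch_def
    by (subst (1 2) sum.remove[of _ a]) (auto simp: algebra_simps intro!: sum.cong split: if_splits)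
qed

text \<open>The operator of the last list entry acts first. Splitting that entry off leaves a
  \<open>foldr\<close> that starts from a map other than \<open>id\<close>; this lemma restores the
  start \<open>id\<close>.\<close>

lemma foldr_comp_eq: "foldr (\<lambda>r E. h r \<circ> E) xs g = foldr (\<lambda>r E. h r \<circ> E) xs id \<circ> g"
proof (induction xs)
  case Nil
  show ?case by simp
next
  case (Cons x xs)
  then show ?case by (simp add: fun_eq_iff)
qed

section \<open>Differential operators acting on powers of the pairing\<close>

context
  fixes m :: nat and u :: "nat \<Rightarrow> complex" and lg :: "complex \<Rightarrow> complex" and D :: "complex set"
  assumes m: "m \<ge> 1" and lg: "log_branch D lg"
begin

text \<open>The formula for \<open>F\<close> is required only where the pairing lies in
  \<open>D\<close>. As \<open>D\<close> is open and the pairing is affine in each coordinate, this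
  covers a neighbourhood, which suffices for the derivative. The result has the shape of the
  assumption, so the lemma can be iterated.\<close>

lemma pd_bracket_pow:
  assumes a: "a \<in> {2..2*m}" and zt: "bracket m u (patch zt) \<in> D"
    and F: "\<And>y. bracket m u (patch y) \<in> D \<Longrightarrow> F y = C * bracket_pow m u lg s y"
  shows "pd a F zt = C * (- s * u a) * bracket_pow m u lg (s + 1) zt"
proof -
  let ?b = "\<lambda>t. bracket m u (patch zt) + u a * (t - zt a)"
  let ?x = "bracket m u (patch zt)"
  have D: "open D" using lg by (auto simp: log_branch_def)
  have x: "exp (lg ?x) = ?x" using lg zt by (auto simp: log_branch_def)
  have op: "open (?b -` D)"
    by (intro open_vimage D continuous_intros)
  have d: "((\<lambda>t. lg (?b t)) has_field_derivative 1 / ?x * u a) (at (zt a))"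
  proof (rule DERIV_chain2[of lg])
    show "(lg has_field_derivative 1 / ?x) (at (?b (zt a)))"
      using log_branch_has_field_derivative[OF lg zt] by simp
  qed (auto intro!: derivative_eq_intros)
  have "((\<lambda>t. C * exp (- s * lg (?b t))) has_field_derivative
      C * (exp (- s * lg (?b (zt a))) * (- s * (1 / ?x * u a)))) (at (zt a))"
    by (intro DERIV_cmult DERIV_chain2[OF DERIV_exp] d)
  then have "((\<lambda>t. F (zt(a := t))) has_field_derivative
      C * (exp (- s * lg (?b (zt a))) * (- s * (1 / ?x * u a)))) (at (zt a))"
  proof (rule has_field_derivative_transform_within_open[OF _ op])
    fix t assume "t \<in> ?b -` D"
    then show "C * exp (- s * lg (?b t)) = F (zt(a := t))"
      by (simp add: F bracket_patch_upd[OF a] bracket_pow_def)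
  qed (use zt in auto)
  then have "pd a F zt = C * (- s * u a) * (exp (- s * lg ?x) / ?x)"
    by (simp add: pd_def DERIV_imp_deriv)
  \<comment> \<open>The chain rule produces a factor \<open>1 / ?x\<close>; written as
    \<open>exp (- lg ?x)\<close> it raises the exponent from \<open>s\<close> to
    \<open>s + 1\<close>.\<close>
  also have "exp (- s * lg ?x) / ?x = exp (- s * lg ?x) / exp (lg ?x)"
    by (simp add: x)
  also have "\<dots> = bracket_pow m u lg (s + 1) zt"
    by (simp add: bracket_pow_def ring_distribs flip: exp_diff)
  finally show ?thesis .
qed

text \<open>The derivative number \<open>k\<close>, counted from 0, contributes
  \<open>- (s + k) * u a\<close>; the product of the factors \<open>s + k\<close> is the Pochhammer
  symbol.\<close>

lemma pd_funpow_bracket_pow: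
  assumes a: "a \<in> {2..2*m}" and zt: "bracket m u (patch zt) \<in> D"
    and F: "\<And>y. bracket m u (patch y) \<in> D \<Longrightarrow> F y = C * bracket_pow m u lg s y"
  shows "(pd a ^^ n) F zt
    = C * ((- u a) ^ n * pochhammer s n) * bracket_pow m u lg (s + of_nat n) zt"
  using zt
proof (induction n arbitrary: zt)
  case 0
  then show ?case by (simp add: F)
next
  case (Suc n)
  show ?case
    using pd_bracket_pow[OF a Suc.prems Suc.IH]
    by (simp add: pochhammer_Suc algebra_simps)
qed

text \<open>An arbitrary list makes the induction possible. The next block of derivatives starts at
  the exponent where the previous one stopped, so the Pochhammer symbols join into a single
  one.\<close>

lemma pd_foldr_bracket_pow:
  assumes "set xs \<subseteq> {2..2*m}" and zt: "bracket m u (patch zt) \<in> D"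
    and F: "\<And>y. bracket m u (patch y) \<in> D \<Longrightarrow> F y = C * bracket_pow m u lg s y"
  shows "foldr (\<lambda>b E. (pd b ^^ q b) \<circ> E) xs id F zt
    = C * ((\<Prod>b\<leftarrow>xs. (- u b) ^ q b) * pochhammer s (\<Sum>b\<leftarrow>xs. q b))
        * bracket_pow m u lg (s + of_nat (\<Sum>b\<leftarrow>xs. q b)) zt"
  using assms(1) zt
proof (induction xs arbitrary: zt)
  case Nil
  then show ?case by (simp add: F)
next
  case (Cons b xs)
  have b: "b \<in> {2..2*m}" and xs: "set xs \<subseteq> {2..2*m}" using Cons.prems by auto
  show ?case
    using pd_funpow_bracket_pow[OF b Cons.prems(2) Cons.IH[OF xs], of "q b"]
      pochhammer_product'[of s "\<Sum>b\<leftarrow>xs. q b" "q b"]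
    by (simp add: add_ac mult_ac)
qed

lemma pd_multi_bracket_pow:
  assumes zt: "bracket m u (patch zt) \<in> D"
    and F: "\<And>y. bracket m u (patch y) \<in> D \<Longrightarrow> F y = C * bracket_pow m u lg s y"
  shows "pd_multi m q F zt
    = C * ((\<Prod>b=2..2*m. (- u b) ^ q b) * pochhammer s (\<Sum>b=2..2*m. q b))
        * bracket_pow m u lg (s + of_nat (\<Sum>b=2..2*m. q b)) zt"
proof -
  have set: "set [2..<2*m+1] = {2..2*m}" by auto
  have "(\<Prod>b\<leftarrow>[2..<2*m+1]. (- u b) ^ q b) = (\<Prod>b=2..2*m. (- u b) ^ q b)"
    by (metis set distinct_upt prod.distinct_set_conv_list)
  moreover have "(\<Sum>b\<leftarrow>[2..<2*m+1]. q b) = (\<Sum>b=2..2*m. q b)"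
    by (metis set distinct_upt sum.distinct_set_conv_list)
  ultimately show ?thesis
    unfolding pd_multi_def
    using pd_foldr_bracket_pow[of "[2..<2*m+1]", OF _ zt F, of q] set by simp
qed

text \<open>Summing \<open>zt a * u a\<close> over \<open>a\<close> gives the pairing minus
  \<open>u 1\<close>. The pairing lowers \<open>s + 1\<close> back to \<open>s\<close> and cancels
  against \<open>s * F zt\<close>; the \<open>u 1\<close> term survives.\<close>

lemma euler_bracket_pow:
  assumes zt: "bracket m u (patch zt) \<in> D"
    and F: "\<And>y. bracket m u (patch y) \<in> D \<Longrightarrow> F y = C * bracket_pow m u lg s y"
  shows "euler m F zt + s * F zt = C * (s * u 1) * bracket_pow m u lg (s + 1) zt"
proof -
  have "euler m F zt = (\<Sum>a=2..2*m. - C * s * bracket_pow m u lg (s + 1) zt * (u a * zt a))"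
    unfolding euler_def by (intro sum.cong refl) (simp add: pd_bracket_pow[OF _ zt F])
  also have "\<dots> = - C * s * bracket_pow m u lg (s + 1) zt * (bracket m u (patch zt) - u 1)"
    by (simp only: bracket_patch[OF m] add_diff_cancel_left' sum_distrib_left)
  finally show ?thesis
    using bracket_pow_step[OF lg zt, of 1 s, symmetric] by (simp add: F[OF zt] algebra_simps)
qed

text \<open>The factor with \<open>r = k - 1\<close> acts first, and its constant
  \<open>\<Delta> - 2 - r\<close> equals the exponent \<open>\<Delta> - 1 - k\<close> of
  \<open>F\<close>. Constant and exponent then rise together, so the previous lemma applies to every
  factor.\<close>

lemma euler_prod_bracket_pow:
  assumes zt: "bracket m u (patch zt) \<in> D"
    and F: "\<And>y. bracket m u (patch y) \<in> D \<Longrightarrow>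
      F y = C * bracket_pow m u lg (\<Delta> - 1 - of_nat k) y"
  shows "euler_prod m \<Delta> k F zt
    = C * (u 1 ^ k * pochhammer (\<Delta> - 1 - of_nat k) k) * bracket_pow m u lg (\<Delta> - 1) zt"
  using F
proof (induction k arbitrary: F C)
  case 0
  then show ?case using zt by (simp add: euler_prod_def)
next
  case (Suc k)
  let ?s = "\<Delta> - 2 - of_nat k"
  have s: "\<Delta> - 1 - of_nat (Suc k) = ?s" by simp
  have "euler_prod m \<Delta> (Suc k) F zt
      = euler_prod m \<Delta> k (\<lambda>y. euler m F y + ?s * F y) zt"
    unfolding euler_prod_def upt_Suc_append[OF le0] foldr_append
    by (subst foldr_comp_eq) simp
  also have "\<dots> = (C * (?s * u 1)) * (u 1 ^ k * pochhammer (\<Delta> - 1 - of_nat k) k)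
      * bracket_pow m u lg (\<Delta> - 1) zt"
  proof (rule Suc.IH)
    fix y assume y: "bracket m u (patch y) \<in> D"
    have "?s + 1 = \<Delta> - 1 - of_nat k" by simp
    then show "euler m F y + ?s * F y
        = C * (?s * u 1) * bracket_pow m u lg (\<Delta> - 1 - of_nat k) y"
      using euler_bracket_pow[OF y, of F C ?s] Suc.prems unfolding s by metis
  qed
  also have "\<dots> = C * (u 1 ^ Suc k * pochhammer (\<Delta> - 1 - of_nat (Suc k)) (Suc k))
      * bracket_pow m u lg (\<Delta> - 1) zt"
  proof -
    have "?s + 1 = \<Delta> - 1 - of_nat k" by simp
    then show ?thesis
      unfolding s pochhammer_rec by (simp only: power_Suc mult_ac)
  qed
  finally show ?case .
qed

end

section \<open>The multinomial theorem over a finite index set\<close>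

text \<open>Exponents are extensional functions, to match the index set of
  \<open>euler_expanded\<close>. Induction on \<open>A\<close>: the binomial theorem splits off the
  exponent \<open>k\<close> of the new element.\<close>

lemma multinomial_theorem:
  fixes x :: "'a \<Rightarrow> 'b::field_char_0"
  assumes "finite A"
  shows "(\<Sum>b\<in>A. x b) ^ L
    = (\<Sum>l\<in>{l \<in> A \<rightarrow>\<^sub>E UNIV. sum l A = L}. fact L / (\<Prod>b\<in>A. fact (l b)) * (\<Prod>b\<in>A. x b ^ l b))"
  using assms
proof (induction A arbitrary: L rule: finite_induct)
  case empty
  show ?case by (cases "L = 0") auto
next
  case (insert a A)
  define S where "S = (\<lambda>(A::'a set) L. {l \<in> A \<rightarrow>\<^sub>E (UNIV::nat set). sum l A = L})"
  define T where "T = (\<lambda>(A::'a set) L l. fact L / (\<Prod>b\<in>A. fact (l b)) * (\<Prod>b\<in>A. x b ^ l b))"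
  have fin: "finite (S A k)" for k
  proof (rule finite_subset)
    show "S A k \<subseteq> A \<rightarrow>\<^sub>E {..k}"
    proof
      fix l assume l: "l \<in> S A k"
      then have "l b \<le> k" if "b \<in> A" for b
        using member_le_sum[of b A l] that insert.hyps(1) by (simp add: S_def)
      then show "l \<in> A \<rightarrow>\<^sub>E {..k}" using l by (auto simp: S_def PiE_iff)
    qed
  qed (simp add: finite_PiE insert.hyps(1))
  have upd: "sum (l(a := k)) A = sum l A" "(\<Prod>b\<in>A. fact ((l(a := k)) b)) = (\<Prod>b\<in>A. fact (l b) :: 'b)"
    "(\<Prod>b\<in>A. x b ^ (l(a := k)) b) = (\<Prod>b\<in>A. x b ^ l b)" for l :: "'a \<Rightarrow> nat" and k
    by (rule sum.cong prod.cong; use insert.hyps in auto)+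
  have "(\<Sum>b\<in>insert a A. x b) ^ L = (x a + sum x A) ^ L"
    using insert.hyps by simp
  also have "\<dots> = (\<Sum>k\<le>L. of_nat (L choose k) * x a ^ k * sum x A ^ (L - k))"
    by (rule binomial_ring)
  also have "\<dots> = (\<Sum>k\<le>L. \<Sum>l\<in>S A (L - k). of_nat (L choose k) * x a ^ k * T A (L - k) l)"
    using insert.IH by (simp add: S_def T_def sum_distrib_left)
  also have "\<dots> = (\<Sum>(k, l)\<in>(SIGMA k:{..L}. S A (L - k)). of_nat (L choose k) * x a ^ k * T A (L - k) l)"
    by (rule sum.Sigma) (use fin in auto)
  also have "\<dots> = (\<Sum>l\<in>S (insert a A) L. T (insert a A) L l)"
  \<comment> \<open>A pair \<open>(k, l)\<close> corresponds to \<open>l\<close> extended by the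
    value \<open>k\<close> at \<open>a\<close>. The inverse must reset that value to
    \<open>undefined\<close>, as extensionality on \<open>A\<close> demands.\<close>
  proof (rule sum.reindex_bij_witness[where i = "\<lambda>l. (l a, l(a := undefined))"
        and j = "\<lambda>(k, l). l(a := k)"])
    fix kl assume kl: "kl \<in> (SIGMA k:{..L}. S A (L - k))"
    obtain k l where [simp]: "kl = (k, l)" by (cases kl)
    have k: "k \<le> L" and l: "l \<in> A \<rightarrow>\<^sub>E UNIV" "sum l A = L - k"
      using kl by (auto simp: S_def)
    have "l a = undefined" using l insert.hyps by (auto simp: PiE_iff extensional_def)
    then show "(\<lambda>l. (l a, l(a := undefined))) ((\<lambda>(k, l). l(a := k)) kl) = kl"
      by (auto simp: fun_eq_iff)
    have "sum (l(a := k)) (insert a A) = L"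
      unfolding sum.insert[OF insert.hyps(1,2)] upd l using k by simp
    moreover have "l(a := k) \<in> insert a A \<rightarrow>\<^sub>E UNIV"
      using l(1) by (intro PiE_fun_upd) auto
    ultimately show "(\<lambda>(k, l). l(a := k)) kl \<in> S (insert a A) L"
      by (simp only: S_def mem_Collect_eq prod.case \<open>kl = (k, l)\<close> simp_thms)
    have "T (insert a A) L (l(a := k)) = fact L / (fact k * (\<Prod>b\<in>A. fact (l b)))
        * (x a ^ k * (\<Prod>b\<in>A. x b ^ l b))"
      unfolding T_def prod.insert[OF insert.hyps(1,2)] upd by (simp only: fun_upd_same)
    also have "\<dots> = of_nat (L choose k) * x a ^ k * T A (L - k) l"
      unfolding T_def binomial_fact[OF k] by simp
    finally show "T (insert a A) L ((\<lambda>(k, l). l(a := k)) kl)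
      = (case kl of (k, l) \<Rightarrow> of_nat (L choose k) * x a ^ k * T A (L - k) l)"
      by (simp only: prod.case \<open>kl = (k, l)\<close>)
  next
    fix l assume l: "l \<in> S (insert a A) L"
    have sum: "l a + sum l A = L" using l insert.hyps by (simp add: S_def)
    show "(\<lambda>(k, l). l(a := k)) ((\<lambda>l. (l a, l(a := undefined))) l) = l" by simp
    have "l(a := undefined) \<in> A \<rightarrow>\<^sub>E UNIV"
      using l insert.hyps(2) by (auto simp: S_def PiE_iff extensional_def)
    moreover have "sum (l(a := undefined)) A = L - l a"
      unfolding upd using sum by simp
    ultimately show "(l a, l(a := undefined)) \<in> (SIGMA k:{..L}. S A (L - k))"
      using sum by (simp only: S_def mem_Collect_eq mem_Sigma_iff atMost_iff simp_thms)
  qed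
  finally show ?case by (simp add: S_def T_def)
qed

section \<open>Holomorphy across the diagonal\<close>

lemma regular2I:
  assumes "continuous_on (U \<times> U) (\<lambda>p. R (fst p) (snd p))"
    and "\<And>y. y \<in> U \<Longrightarrow> (\<lambda>x. R x y) holomorphic_on U"
    and "\<And>x. x \<in> U \<Longrightarrow> R x holomorphic_on U"
  shows "regular2 U R"
  using assms by (simp add: regular2_def case_prod_unfold)

lemma regular2D:
  assumes "regular2 U R"
  shows "continuous_on (U \<times> U) (\<lambda>p. R (fst p) (snd p))"
    and "y \<in> U \<Longrightarrow> (\<lambda>x. R x y) holomorphic_on U"
    and "x \<in> U \<Longrightarrow> R x holomorphic_on U"
  using assms by (simp_all add: regular2_def case_prod_unfold)

lemma regular2_add:
  assumes R: "regular2 U R" and S: "regular2 U S"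
  shows "regular2 U (\<lambda>x y. R x y + S x y)"
proof (rule regular2I)
  show "continuous_on (U \<times> U) (\<lambda>p. R (fst p) (snd p) + S (fst p) (snd p))"
    using regular2D(1)[OF R] regular2D(1)[OF S] by (rule continuous_on_add)
  show "(\<lambda>x. R x y + S x y) holomorphic_on U" if "y \<in> U" for y
    using regular2D(2)[OF R that] regular2D(2)[OF S that] by (rule holomorphic_on_add)
  show "(\<lambda>y. R x y + S x y) holomorphic_on U" if "x \<in> U" for x
    using regular2D(3)[OF R that] regular2D(3)[OF S that] by (rule holomorphic_on_add)
qed

lemma regular2_mult:
  assumes R: "regular2 U R" and S: "regular2 U S"
  shows "regular2 U (\<lambda>x y. R x y * S x y)"
proof (rule regular2I)
  show "continuous_on (U \<times> U) (\<lambda>p. R (fst p) (snd p) * S (fst p) (snd p))"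
    using regular2D(1)[OF R] regular2D(1)[OF S] by (rule continuous_on_mult)
  show "(\<lambda>x. R x y * S x y) holomorphic_on U" if "y \<in> U" for y
    using regular2D(2)[OF R that] regular2D(2)[OF S that] by (rule holomorphic_on_mult)
  show "(\<lambda>y. R x y * S x y) holomorphic_on U" if "x \<in> U" for x
    using regular2D(3)[OF R that] regular2D(3)[OF S that] by (rule holomorphic_on_mult)
qed

lemma regular2_sum:
  assumes "\<And>i. i \<in> I \<Longrightarrow> regular2 U (R i)"
  shows "regular2 U (\<lambda>x y. \<Sum>i\<in>I. R i x y)"
proof (rule regular2I)
  show "continuous_on (U \<times> U) (\<lambda>p. \<Sum>i\<in>I. R i (fst p) (snd p))"
    using regular2D(1)[OF assms] by (rule continuous_on_sum)
  show "(\<lambda>x. \<Sum>i\<in>I. R i x y) holomorphic_on U" if "y \<in> U" for y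
    using regular2D(2)[OF assms that] by (rule holomorphic_on_sum)
  show "(\<lambda>y. \<Sum>i\<in>I. R i x y) holomorphic_on U" if "x \<in> U" for x
    using regular2D(3)[OF assms that] by (rule holomorphic_on_sum)
qed

lemma regular2_fst:
  assumes "g holomorphic_on U"
  shows "regular2 U (\<lambda>x y. g x)"
proof (rule regular2I)
  show "continuous_on (U \<times> U) (\<lambda>p. g (fst p))"
    by (rule continuous_on_compose2[OF holomorphic_on_imp_continuous_on[OF assms]
          continuous_on_fst[OF continuous_on_id]]) auto
qed (use assms in simp_all)

lemma regular2_snd:
  assumes "g holomorphic_on U"
  shows "regular2 U (\<lambda>x y. g y)"
proof (rule regular2I)
  show "continuous_on (U \<times> U) (\<lambda>p. g (snd p))"
    by (rule continuous_on_compose2[OF holomorphic_on_imp_continuous_on[OF assms]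
          continuous_on_snd[OF continuous_on_id]]) auto
qed (use assms in simp_all)

section \<open>Divided differences of holomorphic functions\<close>

text \<open>The derivative on the diagonal is the value that removes the singularity of the
  quotient. These functions measure the error of evaluating at \<open>z'\<close> instead of
  \<open>z\<close> under a simple pole.\<close>

definition divided_difference :: "(complex \<Rightarrow> complex) \<Rightarrow> complex \<Rightarrow> complex \<Rightarrow> complex" where
  "divided_difference h x y = (if x = y then deriv h y else (h x - h y) / (x - y))"

lemma divided_difference_sym: "divided_difference h x y = divided_difference h y x"
  unfolding divided_difference_def by (metis minus_diff_eq minus_divide_divide)

text \<open>Near \<open>a\<close> the function \<open>h z - deriv h a * z\<close> has derivative of
  norm at most \<open>e\<close>, hence Lipschitz constant \<open>e\<close> on a convex ball. Both
  variables move at once, as joint continuity requires.\<close>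

lemma divided_difference_near_diagonal:
  assumes "open U" "h holomorphic_on U" "a \<in> U" "e > 0"
  shows "\<exists>d>0. \<forall>x\<in>ball a d. \<forall>y\<in>ball a d. dist (divided_difference h x y) (deriv h a) \<le> e"
proof -
  have "continuous_on U (deriv h)"
    using assms by (intro holomorphic_on_imp_continuous_on holomorphic_deriv)
  then have "isCont (deriv h) a"
    using assms by (simp add: continuous_on_eq_continuous_at)
  then obtain d1 where d1: "d1 > 0" "\<And>x. dist x a < d1 \<Longrightarrow> dist (deriv h x) (deriv h a) < e"
    using \<open>e > 0\<close> unfolding continuous_at_eps_delta by blast
  obtain d2 where d2: "d2 > 0" "ball a d2 \<subseteq> U" using assms open_contains_ball by blast
  define d where "d = min d1 d2"
  have bd: "norm (deriv h x - deriv h a) \<le> e" if "x \<in> ball a d" for x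
    using d1(2)[of x] that by (auto simp: d_def dist_norm norm_minus_commute)
  have "dist (divided_difference h x y) (deriv h a) \<le> e" if x: "x \<in> ball a d" and y: "y \<in> ball a d" for x y
  proof (cases "x = y")
    case True
    then show ?thesis using bd[OF y] by (simp add: divided_difference_def dist_norm)
  next
    case False
    have "norm ((h x - deriv h a * x) - (h y - deriv h a * y)) \<le> e * norm (x - y)"
    proof (rule field_differentiable_bound[where S = "ball a d"])
      fix z assume z: "z \<in> ball a d"
      then have "(h has_field_derivative deriv h z) (at z within ball a d)"
        using assms(1,2) d2 by (intro holomorphic_derivI[of h U] has_field_derivative_at_within) (auto simp: d_def)
      then show "((\<lambda>z. h z - deriv h a * z) has_field_derivative deriv h z - deriv h a) (at z within ball a d)"
        by (intro DERIV_diff DERIV_cmult_Id)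
    qed (use x y bd in auto)
    moreover have "(h x - deriv h a * x) - (h y - deriv h a * y)
        = (divided_difference h x y - deriv h a) * (x - y)"
      using False by (simp add: divided_difference_def left_diff_distrib[of _ "deriv h a"] right_diff_distrib[of "deriv h a"])
    ultimately show ?thesis
      using False by (simp add: norm_mult dist_norm)
  qed
  then show ?thesis using d1 d2 by (intro exI[of _ d]) (auto simp: d_def)
qed

text \<open>Separate holomorphy is removal of the singularity in one variable and symmetry for the
  other. Joint continuity is that of a quotient off the diagonal and the preceding estimate on
  it.\<close>

lemma regular2_divided_difference:
  assumes U: "open U" and h: "h holomorphic_on U"
  shows "regular2 U (divided_difference h)"
  unfolding regular2_def
proof (intro conjI ballI)
  show hol: "(\<lambda>x. divided_difference h x y) holomorphic_on U" for y
    using pole_lemma_open[OF h U, of y] unfolding divided_difference_def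
    by (rule holomorphic_transform) auto
  then show "(\<lambda>y. divided_difference h x y) holomorphic_on U" for x
    by (subst divided_difference_sym)
  have "isCont (\<lambda>(x, y). divided_difference h x y) (a, b)" if ab: "a \<in> U" "b \<in> U" for a b
  proof (cases "a = b")
    case True
    show ?thesis
      unfolding continuous_at_eps_delta
    proof (intro allI impI)
      fix e :: real assume "e > 0"
      then obtain d where d: "d > 0"
        "\<And>x y. x \<in> ball a d \<Longrightarrow> y \<in> ball a d \<Longrightarrow> dist (divided_difference h x y) (deriv h a) \<le> e / 2"
        using divided_difference_near_diagonal[OF U h ab(1), of "e / 2"] by auto
      show "\<exists>d>0. \<forall>p. dist p (a, b) < d \<longrightarrow>
          dist (case p of (x, y) \<Rightarrow> divided_difference h x y) (case (a, b) of (x, y) \<Rightarrow> divided_difference h x y) < e"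
      proof (intro exI[of _ d] conjI allI impI d(1))
        fix p assume p: "dist p (a, b) < d"
        obtain x y where [simp]: "p = (x, y)" by (cases p)
        have "x \<in> ball a d" "y \<in> ball a d"
          using p dist_fst_le[of p "(a, b)"] dist_snd_le[of p "(a, b)"] True
          by (auto simp: dist_commute)
        then show "dist (case p of (x, y) \<Rightarrow> divided_difference h x y)
            (case (a, b) of (x, y) \<Rightarrow> divided_difference h x y) < e"
          using d(2)[of x y] \<open>e > 0\<close> True by (simp add: divided_difference_def)
      qed
    qed
  next
    case False
    define W where "W = (U \<times> U) \<inter> {p. fst p \<noteq> snd p}"
    have "open {p :: complex \<times> complex. fst p \<noteq> snd p}"
      by (rule open_Collect_neq[OF continuous_on_fst[OF continuous_on_id] continuous_on_snd[OF continuous_on_id]])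
    then have W: "open W" "(a, b) \<in> W"
      using U ab False by (auto simp: W_def open_Times)
    note hc = holomorphic_on_imp_continuous_on[OF h]
    have "continuous_on W (\<lambda>p. h (fst p))"
      by (rule continuous_on_compose2[OF hc continuous_on_fst[OF continuous_on_id]]) (auto simp: W_def)
    moreover have "continuous_on W (\<lambda>p. h (snd p))"
      by (rule continuous_on_compose2[OF hc continuous_on_snd[OF continuous_on_id]]) (auto simp: W_def)
    ultimately have "continuous_on W (\<lambda>p. (h (fst p) - h (snd p)) / (fst p - snd p))"
      by (intro continuous_on_divide continuous_on_diff continuous_on_fst continuous_on_snd continuous_on_id)
        (auto simp: W_def)
    then have "continuous_on W (\<lambda>(x, y). divided_difference h x y)"
      by (rule continuous_on_eq) (auto simp: W_def divided_difference_def)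
    then show ?thesis
      using W by (simp add: continuous_on_eq_continuous_at)
  qed
  then show "continuous_on (U \<times> U) (\<lambda>(x, y). divided_difference h x y)"
    by (intro continuous_at_imp_continuous_on) auto
qed

section \<open>The celestial OPE\<close>

lemma holomorphic_on_bracket_pow:
  assumes "log_branch D lg" "\<And>i. i \<in> {1..2*m} \<Longrightarrow> \<mu> i holomorphic_on V"
    and "\<And>l. l \<in> V \<Longrightarrow> bracket m (\<lambda>i. \<mu> i l) (patch zt) \<in> D"
  shows "(\<lambda>l. bracket_pow m (\<lambda>i. \<mu> i l) lg s zt) holomorphic_on V"
proof -
  have "(\<lambda>l. bracket m (\<lambda>i. \<mu> i l) (patch zt)) holomorphic_on V"
    unfolding bracket_def using assms(2) by (intro holomorphic_intros) auto
  moreover have "lg holomorphic_on D" using assms(1) by (simp add: log_branch_def)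
  ultimately have "(\<lambda>l. lg (bracket m (\<lambda>i. \<mu> i l) (patch zt))) holomorphic_on V"
    using holomorphic_on_compose_gen[of _ V lg D] assms(3) by (auto simp: o_def)
  then show ?thesis
    unfolding bracket_pow_def by (intro holomorphic_intros)
qed

section \<open>Closed forms of the vertex operator and of the charge\<close>

lemma vertex_op_eval:
  assumes V: "open V" "z \<in> V" and j: "j holomorphic_on V"
    and \<mu>: "\<And>i. i \<in> {1..2*m} \<Longrightarrow> \<mu> i holomorphic_on V"
    and lg: "log_branch D lg" and zt: "bracket m (\<lambda>i. \<mu> i z) (patch zt) \<in> D"
  shows "vertex_op m \<mu> lg j \<Delta> z zt
    = (- \<i>) powr (\<Delta> - 1) * Gamma (\<Delta> - 1) * j z * bracket_pow m (\<lambda>i. \<mu> i z) lg (\<Delta> - 1) zt"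
proof -
  let ?x = "\<lambda>l. bracket m (\<lambda>i. \<mu> i l) (patch zt)"
  \<comment> \<open>The pairing is assumed to lie in \<open>D\<close> only at \<open>z\<close>; by
    continuity it does so on this smaller open set. The weak assumption matters because
    \<open>zt\<close> is later varied for differentiation.\<close>
  define W where "W = {l \<in> V. ?x l \<in> D}"
  have "continuous_on V ?x"
    unfolding bracket_def using \<mu>
    by (intro holomorphic_on_imp_continuous_on holomorphic_intros) auto
  then have "open (V \<inter> ?x -` D)"
    using V lg by (intro continuous_open_preimage) (auto simp: log_branch_def)
  moreover have "W = V \<inter> ?x -` D" by (auto simp: W_def)
  ultimately have W: "open W" "z \<in> W" "W \<subseteq> V" using zt V by (auto simp: W_def)
  have eq: "j l / exp ((\<Delta> - 1) * lg (?x l)) = j l * bracket_pow m (\<lambda>i. \<mu> i l) lg (\<Delta> - 1) zt" for l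
    by (simp only: bracket_pow_def mult_minus_left exp_minus divide_inverse)
  have "(\<lambda>l. j l * bracket_pow m (\<lambda>i. \<mu> i l) lg (\<Delta> - 1) zt) holomorphic_on W"
    using W j \<mu> by (intro holomorphic_intros holomorphic_on_bracket_pow[OF lg])
      (auto intro: holomorphic_on_subset simp: W_def)
  then show ?thesis
    unfolding vertex_op_def eq by (simp add: delta_integral_eval[OF W(1,2)])
qed

lemma soft_charge_eval:
  assumes V: "open V" "z \<in> V" and j: "j holomorphic_on V"
    and \<mu>: "\<And>i. i \<in> {1..2*m} \<Longrightarrow> \<mu> i holomorphic_on V"
  shows "soft_charge m \<mu> p j z = \<i> ^ weight m p * (\<Prod>i=1..2*m. \<mu> i z ^ p i) * j z"
proof -
  have "(\<lambda>l. (\<Prod>i=1..2*m. \<mu> i l ^ p i) * j l) holomorphic_on V"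
    using j \<mu> by (intro holomorphic_intros) auto
  then have "circle_integral z (\<lambda>l. (\<Prod>i=1..2*m. \<mu> i l ^ p i)
        * angle iota (aff l) powi (1 - int (weight m p))
        / (angle (aff l) (aff z) * angle iota (aff z) powi (1 - int (weight m p))) * j l)
      = 2 * of_real pi * \<i> * ((\<Prod>i=1..2*m. \<mu> i z ^ p i) * j z)"
    by (rule circle_integral_eval[OF V]) (simp add: angle_def aff_def iota_def)
  moreover have "x / c * (c * y) = x * y" if "c \<noteq> 0" for c x y :: complex
    using that by simp
  ultimately show ?thesis
    unfolding soft_charge_def by (simp add: mult.assoc del: times_divide_eq_left)
qed

text \<open>The current product is holomorphic only off the diagonal. For fixed \<open>l\<close> the
  inner residue at \<open>z'\<close> is taken in \<open>U - {l}\<close>, then the outer one at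
  \<open>z\<close> in \<open>U - {z'}\<close>. So the monomial is evaluated at \<open>z\<close> and
  the pairing at \<open>z'\<close>.\<close>

lemma charge_on_vertex_eval:
  assumes U: "open U" "z \<in> U" "z' \<in> U" "z \<noteq> z'"
    and J1: "\<And>l. l \<in> U \<Longrightarrow> (\<lambda>l'. JJ a b l l') holomorphic_on (U - {l})"
    and J2: "\<And>l'. l' \<in> U \<Longrightarrow> (\<lambda>l. JJ a b l l') holomorphic_on (U - {l'})"
    and \<mu>: "\<And>i. i \<in> {1..2*m} \<Longrightarrow> \<mu> i holomorphic_on U"
    and lg: "log_branch D lg" and zt: "bracket m (\<lambda>i. \<mu> i z') (patch zt) \<in> D"
  shows "charge_on_vertex m \<mu> lg p JJ a b \<Delta> z z' zt
    = \<i> ^ weight m p * ((- \<i>) powr (\<Delta> - 1) * Gamma (\<Delta> - 1)) * (\<Prod>i=1..2*m. \<mu> i z ^ p i)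
        * bracket_pow m (\<lambda>i. \<mu> i z') lg (\<Delta> - 1) zt * JJ a b z z'"
proof -
  have v: "vertex_op m \<mu> lg (\<lambda>l'. JJ a b l l') \<Delta> z' zt
      = (- \<i>) powr (\<Delta> - 1) * Gamma (\<Delta> - 1) * JJ a b l z'
          * bracket_pow m (\<lambda>i. \<mu> i z') lg (\<Delta> - 1) zt" if "l \<in> U - {z'}" for l
    by (rule vertex_op_eval[of "U - {l}" z' "\<lambda>l'. JJ a b l l'" m \<mu> D lg zt \<Delta>])
      (use that U J1 \<mu> lg zt in \<open>auto intro: holomorphic_on_subset\<close>)
  have "(\<lambda>l. (- \<i>) powr (\<Delta> - 1) * Gamma (\<Delta> - 1) * JJ a b l z'
          * bracket_pow m (\<lambda>i. \<mu> i z') lg (\<Delta> - 1) zt) holomorphic_on U - {z'}"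
    using J2[OF U(3)] by (intro holomorphic_intros)
  then have "(\<lambda>l. vertex_op m \<mu> lg (\<lambda>l'. JJ a b l l') \<Delta> z' zt) holomorphic_on U - {z'}"
    by (rule holomorphic_transform) (simp add: v)
  then show ?thesis
    unfolding charge_on_vertex_def
    by (subst soft_charge_eval[of "U - {z'}"])
      (use U \<mu> v in \<open>auto intro: holomorphic_on_subset\<close>)
qed

section \<open>Gamma prefactors and the values of both differential operators\<close>

lemma Gamma_eq_pochhammer:
  fixes s :: complex
  assumes "s \<notin> \<int>\<^sub>\<le>\<^sub>0"
  shows "Gamma (s + of_nat n) = pochhammer s n * Gamma s"
  using assms by (simp add: pochhammer_Gamma[OF assms] Gamma_eq_zero_iff)

text \<open>Passing from dimension \<open>\<Delta> - P\<close> to \<open>\<Delta>\<close> costs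
  \<open>(- \<i>) ^ P\<close>, which the \<open>\<i> ^ P\<close> of the charge cancels since
  \<open>\<i> * (- \<i>) = 1\<close>. The Pochhammer symbol bridges the two Gamma values.\<close>

lemma vertex_prefactor_shift:
  assumes "\<Delta> - 1 - of_nat P \<notin> \<int>\<^sub>\<le>\<^sub>0"
  shows "(- \<i>) powr (\<Delta> - of_nat P - 1) * Gamma (\<Delta> - of_nat P - 1) * pochhammer (\<Delta> - 1 - of_nat P) P
    = \<i> ^ P * ((- \<i>) powr (\<Delta> - 1) * Gamma (\<Delta> - 1))"
proof -
  have c: "\<Delta> - of_nat P - 1 = \<Delta> - 1 - of_nat P" by simp
  have "(- \<i>) powr (\<Delta> - 1) = (- \<i>) powr (\<Delta> - 1 - of_nat P) * (- \<i>) ^ P"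
    using powr_add[of "- \<i>" "\<Delta> - 1 - of_nat P" "of_nat P"] by simp
  then have "\<i> ^ P * (- \<i>) powr (\<Delta> - 1) = (- \<i>) powr (\<Delta> - 1 - of_nat P) * (\<i> * (- \<i>)) ^ P"
    by (simp only: power_mult_distrib mult_ac)
  moreover have "Gamma (\<Delta> - 1) = pochhammer (\<Delta> - 1 - of_nat P) P * Gamma (\<Delta> - 1 - of_nat P)"
    using Gamma_eq_pochhammer[OF assms, of P] by simp
  ultimately show ?thesis unfolding c by simp
qed

lemma weight_split: "m \<ge> 1 \<Longrightarrow> weight m p = p 1 + (\<Sum>i=2..2*m. p i)"
  and prod_split: "m \<ge> 1 \<Longrightarrow> (\<Prod>i=1..2*m. g i) = (g 1 :: complex) * (\<Prod>i=2..2*m. g i)"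
proof -
  assume "m \<ge> 1"
  then have *: "{1..2*m} = insert 1 {2..2*m}" by auto
  show "weight m p = p 1 + (\<Sum>i=2..2*m. p i)"
    unfolding weight_def * by simp
  show "(\<Prod>i=1..2*m. g i) = g 1 * (\<Prod>i=2..2*m. g i)"
    unfolding * by simp
qed

text \<open>The derivatives raise the exponent by \<open>q\<close> and account for the sign; the
  Euler factors raise it by the remaining \<open>p 1\<close>. The two Pochhammer symbols
  concatenate.\<close>

lemma euler_prod_pd_multi_eval:
  assumes m: "m \<ge> 1" and lg: "log_branch D lg" and zt: "bracket m u (patch zt) \<in> D"
    and F: "\<And>y. bracket m u (patch y) \<in> D \<Longrightarrow>
      F y = C * bracket_pow m u lg (\<Delta> - 1 - of_nat (weight m p)) y"
  shows "euler_prod m \<Delta> (p 1) (pd_multi m p F) zt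
    = C * ((-1) ^ (\<Sum>i=2..2*m. p i) * (\<Prod>i=1..2*m. u i ^ p i)
        * pochhammer (\<Delta> - 1 - of_nat (weight m p)) (weight m p)) * bracket_pow m u lg (\<Delta> - 1) zt"
proof -
  define s where "s = \<Delta> - 1 - of_nat (weight m p)"
  define q where "q = (\<Sum>i=2..2*m. p i)"
  have w: "weight m p = q + p 1" by (simp add: weight_split[OF m] q_def)
  have s: "s + of_nat q = \<Delta> - 1 - of_nat (p 1)" by (simp add: s_def w)
  have "pd_multi m p F y = C * ((\<Prod>b=2..2*m. (- u b) ^ p b) * pochhammer s q)
      * bracket_pow m u lg (\<Delta> - 1 - of_nat (p 1)) y" if "bracket m u (patch y) \<in> D" for y
    unfolding s[symmetric] q_def s_def by (rule pd_multi_bracket_pow[OF m lg that F])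
  then have "euler_prod m \<Delta> (p 1) (pd_multi m p F) zt
      = C * ((\<Prod>b=2..2*m. (- u b) ^ p b) * pochhammer s q)
        * (u 1 ^ p 1 * pochhammer (s + of_nat q) (p 1)) * bracket_pow m u lg (\<Delta> - 1) zt"
    unfolding s by (rule euler_prod_bracket_pow[OF m lg zt])
  also have "(\<Prod>b=2..2*m. (- u b) ^ p b) = (-1) ^ q * (\<Prod>b=2..2*m. u b ^ p b)"
    by (simp add: q_def power_minus[of "u _"] prod.distrib power_sum)
  finally show ?thesis
    unfolding s_def[symmetric] q_def[symmetric]
    unfolding w prod_split[OF m] pochhammer_product'
    by (simp only: mult_ac)
qed

lemma euler_expanded_eval:
  assumes m: "m \<ge> 1" and lg: "log_branch D lg" and zt: "bracket m u (patch zt) \<in> D"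
    and F: "\<And>y. bracket m u (patch y) \<in> D \<Longrightarrow>
      F y = C * bracket_pow m u lg (\<Delta> - 1 - of_nat (weight m p)) y"
    and s: "\<Delta> - 1 - of_nat (weight m p) \<notin> \<int>\<^sub>\<le>\<^sub>0"
  shows "euler_expanded m \<Delta> p F zt
    = C * ((-1) ^ (\<Sum>i=2..2*m. p i) * (\<Prod>i=1..2*m. u i ^ p i)
        * pochhammer (\<Delta> - 1 - of_nat (weight m p)) (weight m p)) * bracket_pow m u lg (\<Delta> - 1) zt"
proof -
  define s where "s = \<Delta> - 1 - of_nat (weight m p)"
  define q where "q = (\<Sum>i=2..2*m. p i)"
  define x where "x = bracket m u (patch zt)"
  define G where "G = (\<lambda>s. bracket_pow m u lg s zt)"
  define K where "K = C * (\<Prod>b=2..2*m. (- u b) ^ p b)"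
  have w: "weight m p = q + p 1" by (simp add: weight_split[OF m] q_def)
  have d: "\<Delta> - 1 = s + of_nat q + of_nat (p 1)" by (simp add: s_def w)
  have s0: "s \<notin> \<int>\<^sub>\<le>\<^sub>0" using assms by (simp add: s_def)
  \<comment> \<open>The Pochhammer symbol and the exponent depend on \<open>l\<close> only through
    its sum \<open>L\<close>, so they factor out. What remains is the multinomial expansion of the
    sum of \<open>- u b * zt b\<close>, which is \<open>u 1 - x\<close>.\<close>
  have inner: "(\<Sum>l\<in>{l \<in> {2..2*m} \<rightarrow>\<^sub>E UNIV. (\<Sum>b=2..2*m. l b) = L}.
      fact L / (\<Prod>b=2..2*m. fact (l b)) * (\<Prod>b=2..2*m. zt b ^ l b) * pd_multi m (\<lambda>b. l b + p b) F zt)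
      = (u 1 - x) ^ L * (K * pochhammer s (q + L) * G (s + of_nat (q + L)))" for L
  proof -
    have "(\<Sum>l\<in>{l \<in> {2..2*m} \<rightarrow>\<^sub>E UNIV. (\<Sum>b=2..2*m. l b) = L}.
      fact L / (\<Prod>b=2..2*m. fact (l b)) * (\<Prod>b=2..2*m. zt b ^ l b) * pd_multi m (\<lambda>b. l b + p b) F zt)
      = (\<Sum>l\<in>{l \<in> {2..2*m} \<rightarrow>\<^sub>E UNIV. sum l {2..2*m} = L}.
          fact L / (\<Prod>b=2..2*m. fact (l b)) * (\<Prod>b=2..2*m. (- u b * zt b) ^ l b)
          * (K * pochhammer s (q + L) * G (s + of_nat (q + L))))"
    proof (rule sum.cong)
      fix l assume "l \<in> {l \<in> {2..2*m} \<rightarrow>\<^sub>E UNIV. sum l {2..2*m} = L}"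
      then have "(\<Sum>b=2..2*m. l b + p b) = q + L"
        by (simp add: sum.distrib q_def)
      then have "pd_multi m (\<lambda>b. l b + p b) F zt
          = C * ((\<Prod>b=2..2*m. (- u b) ^ (l b + p b)) * pochhammer s (q + L)) * G (s + of_nat (q + L))"
        using pd_multi_bracket_pow[OF m lg zt F, of "\<lambda>b. l b + p b"] by (simp add: s_def G_def)
      moreover have "(\<Prod>b=2..2*m. (- u b * zt b) ^ l b) * (\<Prod>b=2..2*m. (- u b) ^ p b)
          = (\<Prod>b=2..2*m. zt b ^ l b) * (\<Prod>b=2..2*m. (- u b) ^ (l b + p b))"
        unfolding prod.distrib[symmetric] by (intro prod.cong refl) (simp only: power_mult_distrib power_add mult_ac)
      ultimately show "fact L / (\<Prod>b=2..2*m. fact (l b)) * (\<Prod>b=2..2*m. zt b ^ l b) * pd_multi m (\<lambda>b. l b + p b) F zt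
        = fact L / (\<Prod>b=2..2*m. fact (l b)) * (\<Prod>b=2..2*m. (- u b * zt b) ^ l b)
          * (K * pochhammer s (q + L) * G (s + of_nat (q + L)))"
        by (simp only: K_def mult_ac)
    qed simp
    also have "\<dots> = (\<Sum>b=2..2*m. - u b * zt b) ^ L * (K * pochhammer s (q + L) * G (s + of_nat (q + L)))"
      by (simp only: multinomial_theorem[OF finite_atLeastAtMost] sum_distrib_right)
    also have "(\<Sum>b=2..2*m. - u b * zt b) = u 1 - x"
      by (simp add: x_def bracket_patch[OF m] sum_negf)
    finally show ?thesis .
  qed
  \<comment> \<open>The Gamma quotient completes the Pochhammer symbol to length
    \<open>weight m p\<close>, and the missing powers of the pairing appear as
    \<open>x ^ (p 1 - L)\<close>. No other dependence on \<open>L\<close> is left.\<close>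
  have outer: "Gamma (\<Delta> - 1) / Gamma (\<Delta> - 1 - of_nat (p 1) + of_nat L)
      * (pochhammer s (q + L) * G (s + of_nat (q + L)))
      = pochhammer s (weight m p) * G (\<Delta> - 1) * x ^ (p 1 - L)" if L: "L \<le> p 1" for L
  proof -
    have e: "\<Delta> - 1 - of_nat (p 1) + of_nat L = s + of_nat (q + L)" by (simp add: d)
    have e2: "\<Delta> - 1 = s + of_nat (weight m p)" by (simp add: s_def)
    have "\<Delta> - 1 = s + of_nat (q + L) + of_nat (p 1 - L)" using L by (simp add: d of_nat_diff)
    then have G: "x ^ (p 1 - L) * G (\<Delta> - 1) = G (s + of_nat (q + L))"
      unfolding x_def G_def using bracket_pow_step[OF lg zt] by metis
    have Gam: "Gamma (s + of_nat (q + L)) = pochhammer s (q + L) * Gamma s"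
      "Gamma (s + of_nat (weight m p)) = pochhammer s (weight m p) * Gamma s"
      by (rule Gamma_eq_pochhammer[OF s0])+
    have nz: "Gamma s \<noteq> 0" using s0 by (simp add: Gamma_eq_zero_iff)
    \<comment> \<open>\<open>Gamma\<close> takes the value 0 exactly at its poles, so staying off
      them is what allows the division.\<close>
    have "s + of_nat (q + L) \<notin> \<int>\<^sub>\<le>\<^sub>0" using s0 nonpos_Ints_diff_Nats[of "s + of_nat (q + L)" "of_nat (q + L)"] by auto
    then have "Gamma (s + of_nat (q + L)) \<noteq> 0" unfolding Gamma_eq_zero_iff .
    then have "pochhammer s (q + L) \<noteq> 0" unfolding Gam by simp
    then show ?thesis
      unfolding e G[symmetric] unfolding e2 Gam using nz by simp
  qed
  have "euler_expanded m \<Delta> p F zt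
      = (\<Sum>L=0..p 1. Gamma (\<Delta> - 1) / Gamma (\<Delta> - 1 - of_nat (p 1) + of_nat L) * of_nat (p 1 choose L)
          * ((u 1 - x) ^ L * (K * pochhammer s (q + L) * G (s + of_nat (q + L)))))"
    unfolding euler_expanded_def inner ..
  also have "\<dots> = (\<Sum>L=0..p 1. K * (of_nat (p 1 choose L) * (u 1 - x) ^ L
      * (Gamma (\<Delta> - 1) / Gamma (\<Delta> - 1 - of_nat (p 1) + of_nat L)
          * (pochhammer s (q + L) * G (s + of_nat (q + L))))))"
    by (simp only: mult_ac)
  also have "\<dots> = (\<Sum>L=0..p 1. K * pochhammer s (weight m p) * G (\<Delta> - 1)
      * (of_nat (p 1 choose L) * (u 1 - x) ^ L * x ^ (p 1 - L)))"
    by (intro sum.cong refl, subst outer) (simp_all add: mult_ac)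
  \<comment> \<open>The binomial theorem for \<open>(u 1 - x) + x\<close> collapses the sum to
    \<open>u 1 ^ p 1\<close>.\<close>
  also have "\<dots> = K * pochhammer s (weight m p) * G (\<Delta> - 1) * u 1 ^ p 1"
    using binomial_ring[of "u 1 - x" x "p 1"]
    by (simp add: atLeast0AtMost flip: sum_distrib_left)
  also have "K = C * ((-1) ^ q * (\<Prod>b=2..2*m. u b ^ p b))"
    by (simp add: K_def q_def power_minus[of "u _"] prod.distrib power_sum)
  finally show ?thesis
    unfolding prod_split[OF m] s_def G_def q_def by (simp only: mult_ac)
qed

theorem mainTheorem7:
  fixes m :: nat
    and f :: "'g::finite \<Rightarrow> 'g \<Rightarrow> 'g \<Rightarrow> complex"
    and J :: "'g \<Rightarrow> complex \<Rightarrow> complex"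
    and JJ :: "'g \<Rightarrow> 'g \<Rightarrow> complex \<Rightarrow> complex \<Rightarrow> complex"
    and \<mu> :: "nat \<Rightarrow> complex \<Rightarrow> complex"
    and U D :: "complex set"
    and lg :: "complex \<Rightarrow> complex"
    and p :: "nat \<Rightarrow> nat"
    and \<Delta> :: complex
    and zt :: "nat \<Rightarrow> complex"
    and a b :: 'g
  assumes "m \<ge> 1"
    and "structure_constants f"
    and "open U"
    and "semiclassical_currents U f J JJ"
    and "\<And>i. i \<in> {1..2*m} \<Longrightarrow> \<mu> i holomorphic_on U"
    and "log_branch D lg"
    and "\<And>l. l \<in> U \<Longrightarrow> bracket m (\<lambda>i. \<mu> i l) (patch zt) \<in> D"
    and "\<Delta> - 1 - of_nat (weight m p) \<notin> \<int>\<^sub>\<le>\<^sub>0"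
  shows "ope_sim U
           (\<lambda>z z'. charge_on_vertex m \<mu> lg p JJ a b \<Delta> z z' zt)
           (\<lambda>z z'. \<Sum>c\<in>UNIV. (-1) ^ (\<Sum>i=2..2*m. p i) * (f a b c / (z - z')) *
              euler_prod m \<Delta> (p 1)
                (pd_multi m p (vertex_op m \<mu> lg (J c) (\<Delta> - of_nat (weight m p)) z)) zt)
       \<and> ope_sim U
           (\<lambda>z z'. charge_on_vertex m \<mu> lg p JJ a b \<Delta> z z' zt)
           (\<lambda>z z'. \<Sum>c\<in>UNIV. (-1) ^ (\<Sum>i=2..2*m. p i) * (f a b c / (z - z')) *
              euler_expanded m \<Delta> p
                (vertex_op m \<mu> lg (J c) (\<Delta> - of_nat (weight m p)) z) zt)
       \<and> (\<forall>c. \<forall>z\<in>U.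
            euler_prod m \<Delta> (p 1)
              (pd_multi m p (vertex_op m \<mu> lg (J c) (\<Delta> - of_nat (weight m p)) z)) zt
            = euler_expanded m \<Delta> p
                (vertex_op m \<mu> lg (J c) (\<Delta> - of_nat (weight m p)) z) zt)"
proof -
  note m = assms(1) and U = assms(3) and cur = assms(4) and \<mu> = assms(5) and lg = assms(6)
    and zt = assms(7) and s = assms(8)
  define P where "P = weight m p"
  define w where "w = (\<lambda>z. \<Prod>i=1..2*m. \<mu> i z ^ p i)"
  define E where "E = (\<lambda>z. bracket_pow m (\<lambda>i. \<mu> i z) lg (\<Delta> - 1) zt)"
  define A where "A = \<i> ^ P * ((- \<i>) powr (\<Delta> - 1) * Gamma (\<Delta> - 1))"
  define C where "C = (- \<i>) powr (\<Delta> - of_nat P - 1) * Gamma (\<Delta> - of_nat P - 1)"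
  have J: "J c holomorphic_on U" for c
    using cur by (simp add: semiclassical_currents_def)
  have w: "w holomorphic_on U"
    unfolding w_def using \<mu> by (intro holomorphic_intros) auto
  have E: "E holomorphic_on U"
    unfolding E_def by (rule holomorphic_on_bracket_pow[OF lg \<mu> zt])
  have "ope_sim U (JJ a b) (\<lambda>x y. \<Sum>c\<in>UNIV. f a b c * (J c y / angle (aff x) (aff y))
      * (angle iota (aff y) / angle iota (aff x)))"
    using cur unfolding semiclassical_currents_def by blast
  then obtain R where R: "regular2 U R"
    and JJ: "\<And>x y. x \<in> U \<Longrightarrow> y \<in> U \<Longrightarrow> x \<noteq> y \<Longrightarrow>
      JJ a b x y = (\<Sum>c\<in>UNIV. f a b c * (J c y / (x - y))) + R x y"
    unfolding ope_sim_def by (auto simp: angle_def aff_def iota_def)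
  \<comment> \<open>Holomorphy of the current product off the diagonal is read off from its OPE; the
    residue evaluation needs it in each variable.\<close>
  have J1: "(\<lambda>y. JJ a b x y) holomorphic_on (U - {x})" if x: "x \<in> U" for x
  proof (rule holomorphic_transform)
    show "(\<lambda>y. (\<Sum>c\<in>UNIV. f a b c * (J c y / (x - y))) + R x y) holomorphic_on (U - {x})"
      by (intro holomorphic_on_add holomorphic_on_sum holomorphic_on_mult holomorphic_on_divide
          holomorphic_on_diff holomorphic_on_const holomorphic_on_ident
          holomorphic_on_subset[OF J] holomorphic_on_subset[OF regular2D(3)[OF R x]]) auto
  qed (use JJ x in auto)
  have J2: "(\<lambda>x. JJ a b x y) holomorphic_on (U - {y})" if y: "y \<in> U" for y
  proof (rule holomorphic_transform)
    show "(\<lambda>x. (\<Sum>c\<in>UNIV. f a b c * (J c y / (x - y))) + R x y) holomorphic_on (U - {y})"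
      by (intro holomorphic_on_add holomorphic_on_sum holomorphic_on_mult holomorphic_on_divide
          holomorphic_on_diff holomorphic_on_const holomorphic_on_ident
          holomorphic_on_subset[OF regular2D(2)[OF R y]]) auto
  qed (use JJ y in auto)
  have lhs: "charge_on_vertex m \<mu> lg p JJ a b \<Delta> z z' zt = A * w z * E z' * JJ a b z z'"
    if "z \<in> U" "z' \<in> U" "z \<noteq> z'" for z z'
    unfolding A_def w_def E_def P_def
    by (rule charge_on_vertex_eval[where JJ = JJ and a = a and b = b and \<mu> = \<mu>, OF U that J1 J2 \<mu> lg zt[OF that(2)]])
  have F: "vertex_op m \<mu> lg (J c) (\<Delta> - of_nat P) z y
      = (C * J c z) * bracket_pow m (\<lambda>i. \<mu> i z) lg (\<Delta> - 1 - of_nat (weight m p)) y"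
    if "z \<in> U" "bracket m (\<lambda>i. \<mu> i z) (patch y) \<in> D" for c z y
    using vertex_op_eval[OF U that(1) J \<mu> lg that(2), of c "\<Delta> - of_nat P"]
    by (simp add: C_def P_def algebra_simps)
  have A: "C * pochhammer (\<Delta> - 1 - of_nat (weight m p)) (weight m p) = A"
    using vertex_prefactor_shift[OF s] by (simp add: C_def A_def P_def)
  have rhs1: "euler_prod m \<Delta> (p 1) (pd_multi m p (vertex_op m \<mu> lg (J c) (\<Delta> - of_nat P) z)) zt
      = (-1) ^ (\<Sum>i=2..2*m. p i) * (A * w z * E z * J c z)" if z: "z \<in> U" for c z
    unfolding A[symmetric] w_def E_def
    by (subst euler_prod_pd_multi_eval[OF m lg zt[OF z] F[OF z]]) (simp_all only: mult_ac)
  have rhs2: "euler_expanded m \<Delta> p (vertex_op m \<mu> lg (J c) (\<Delta> - of_nat P) z) zt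
      = (-1) ^ (\<Sum>i=2..2*m. p i) * (A * w z * E z * J c z)" if z: "z \<in> U" for c z
    unfolding A[symmetric] w_def E_def
    by (subst euler_expanded_eval[OF m lg zt[OF z] F[OF z] s]) (simp_all only: mult_ac)
  \<comment> \<open>The pole carries \<open>J c\<close> and \<open>E\<close> at \<open>z'\<close>,
    the claim has both at \<open>z\<close>. Treating the product as one function gives a single
    divided difference, and \<open>S\<close> collects these with the regular part \<open>R\<close>
    of the current OPE.\<close>
  define H where "H = (\<lambda>c z. J c z * E z)"
  define S where "S = (\<lambda>z z'. A * w z * E z' * R z z'
    + (\<Sum>c\<in>UNIV. - A * f a b c * w z * divided_difference (H c) z z'))"
  have "regular2 U (\<lambda>z z'. A * w z * E z' * R z z')"
    by (intro regular2_mult[OF regular2_mult[OF regular2_fst regular2_snd] R]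
        holomorphic_on_mult holomorphic_on_const w E)
  moreover have "regular2 U (\<lambda>z z'. - A * f a b c * w z * divided_difference (H c) z z')" for c
    unfolding H_def
    by (intro regular2_mult[OF regular2_fst regular2_divided_difference[OF U]]
        holomorphic_on_mult holomorphic_on_const w E J)
  ultimately have S: "regular2 U S"
    unfolding S_def by (intro regular2_add regular2_sum)
  have charge: "charge_on_vertex m \<mu> lg p JJ a b \<Delta> z z' zt
      = (\<Sum>c\<in>UNIV. f a b c / (z - z') * (A * w z * E z * J c z)) + S z z'"
    if z: "z \<in> U" "z' \<in> U" "z \<noteq> z'" for z z'
  proof -
    \<comment> \<open>This writes \<open>H c z'\<close> as \<open>H c z\<close> minus
      \<open>z - z'\<close> times the divided difference; the second term cancels the pole.\<close>
    have "A * w z * E z' * (f a b c * (J c z' / (z - z')))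
        = f a b c / (z - z') * (A * w z * E z * J c z)
          + - A * f a b c * w z * divided_difference (H c) z z'" for c
      using z by (simp add: divided_difference_def H_def divide_simps) (simp add: algebra_simps)
    then have "A * w z * E z' * (\<Sum>c\<in>UNIV. f a b c * (J c z' / (z - z')))
        = (\<Sum>c\<in>UNIV. f a b c / (z - z') * (A * w z * E z * J c z))
          + (\<Sum>c\<in>UNIV. - A * f a b c * w z * divided_difference (H c) z z')"
      by (simp only: sum_distrib_left sum.distrib)
    then show ?thesis
      unfolding lhs[OF z] JJ[OF z] S_def by (simp only: distrib_left add_ac)
  qed
  \<comment> \<open>The explicit sign in the claim cancels the sign produced by the derivatives
    \<open>pd b\<close> with \<open>b\<close> at least 2.\<close>
  have sgn: "(-1) ^ n * x * ((-1) ^ n * y) = x * y" for n and x y :: complex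
    by (simp flip: power_mult_distrib mult.assoc add: mult.commute[of x])
  show ?thesis
    unfolding ope_sim_def P_def[symmetric]
    \<comment> \<open>Both operators have the same value, so one remainder \<open>S\<close> serves
      both operator products.\<close>
    by (intro conjI exI[of _ S] S allI ballI impI; (simp only: rhs1 rhs2 sgn)?; (rule charge)?)
qed

end
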